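(* For integers $\ell\ge 0$ and $k\ge 1$, let $c(\ell,k)$ denote the number of paths in an $X_k$ subtree of $T_B(\infty)$ originating from the root of the $X_k$ subtree (going from father to son) and having length $\ell$. Then $$c(\ell,k)=\begin{cases}1 & \text{if } \ell=0 \text{ or } k=1,\\[2pt] \displaystyle\sum_{i=1}^{\min(\ell,k)}c(\ell-i,i) & \text{otherwise.}\end{cases}$$ Moreover, for $n\ge 1$, the number $|L_B(n)|$ of partitions of $n$ is $c(n,n)$, and for $1\le k\le n$ the number of partitions of $n$ with length exactly $k$ is $c(n-k,k)$.
   Context: A partition is a finite sequence of integers $a=(a_1,\dots,a_k)$ with $a_1\ge\dots\ge a_k>0$ (the empty partition $()$ is allowed); $k$ is its length; by convention $a_j=0$ for $j>k$. $L_B(n)$ is the set of partitions of $n$ (those with $\sum_i a_i=n$). $a^{\downarrow_i}$ denotes the sequence obtained from $a$ by replacing $a_i$ by $a_i+1$. $T_B(\infty)$ is the edge-labeled rooted binary tree with root $()$ in which every node $a$ has a left son $a^{\downarrow_1}$ (edge labeled $1$), and in which a nonempty node $a$ has in addition a right son exactly when, with $p\ge 1$ denoting the number of parts of $a$ equal to $a_1$, one has $a_p-a_{p+1}=1$; the right son is then $a^{\downarrow_{p+1}}$ (edge labeled $p+1$). Its nodes are the partitions generated from the root in this way. For $k\ge 1$, an $X_k$ subtree is a subtree of $T_B(\infty)$ rooted at a node $a=(i,\dots,i,a_{k+1},\dots)$ whose first $k$ parts equal $i$ and with $a_{k+1}\le i-1$, and which is: the whole subtree of $T_B(\infty)$ rooted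 at $a$ if $a$ has only one son; and otherwise $a$ together with its left subtree (the whole subtree rooted at its left son, and the edge to it). For fixed $k$, all $X_k$ subtrees are isomorphic as edge-labeled rooted trees, so $c(\ell,k)$ does not depend on the choice of the $X_k$ subtree. *)

theory Defs
  imports "Graph_Theory.Digraph_Component"
begin

section \<open>Partitions\<close>

definition is_partition :: "nat list \<Rightarrow> bool" where
  "is_partition a \<longleftrightarrow> sorted_wrt (\<ge>) a \<and> (\<forall>x \<in> set a. 0 < x)"

definition L_B :: "nat \<Rightarrow> nat list set" where
  "L_B n = {a. is_partition a \<and> sum_list a = n}"

text \<open>Parts are numbered from 1, and all parts beyond the length are 0.\<close>

definition part :: "nat list \<Rightarrow> nat \<Rightarrow> nat" where
  "part a j = (if 1 \<le> j \<and> j \<le> length a then a ! (j - 1) else 0)"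

definition incr :: "nat \<Rightarrow> nat list \<Rightarrow> nat list" where
  "incr i a = map (\<lambda>j. if j = i then part a j + 1 else part a j) [1..<max (length a) i + 1]"

section \<open>The infinite tree\<close>

definition top_mult :: "nat list \<Rightarrow> nat" where
  "top_mult a = count_list a (part a 1)"

text \<open>\<open>son a i b\<close>: there is an edge labeled \<open>i\<close> from \<open>a\<close> to its son \<open>b\<close>.
  The left son is the one with label 1; right edges have a label of at least 2.\<close>

inductive son :: "nat list \<Rightarrow> nat \<Rightarrow> nat list \<Rightarrow> bool" where
  left: "son a 1 (incr 1 a)"
| right: "a \<noteq> [] \<Longrightarrow> p = top_mult a \<Longrightarrow> part a p = part a (p + 1) + 1 \<Longrightarrow>
    son a (p + 1) (incr (p + 1) a)"

inductive_set TB_nodes :: "nat list set" where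
  root: "[] \<in> TB_nodes"
| son: "a \<in> TB_nodes \<Longrightarrow> son a i b \<Longrightarrow> b \<in> TB_nodes"

text \<open>Distinct tree positions carry distinct partitions (a nonempty partition has exactly one
  father, obtained by decrementing the last of its parts that equal the largest part), so the nodes
  can be identified with their partitions. An arc \<open>(a, i, b)\<close> is the edge from father \<open>a\<close> to son
  \<open>b\<close> with label \<open>i\<close>.\<close>

type_synonym edge = "nat list \<times> nat \<times> nat list"

definition TB :: "(nat list, edge) pre_digraph" where
  "TB = \<lparr> verts = TB_nodes,
          arcs = {(a, i, b). a \<in> TB_nodes \<and> son a i b},
          tail = (\<lambda>(a, i, b). a),
          head = (\<lambda>(a, i, b). b) \<rparr>"

definition subtree_at :: "nat list \<Rightarrow> (nat list, edge) pre_digraph" where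
  "subtree_at a = TB \<restriction> {b. a \<rightarrow>\<^sup>*\<^bsub>TB\<^esub> b}"

definition root_with_left_subtree :: "nat list \<Rightarrow> (nat list, edge) pre_digraph" where
  "root_with_left_subtree a =
     (let L = subtree_at (incr 1 a) in
      \<lparr> verts = insert a (verts L),
        arcs = insert (a, 1, incr 1 a) (arcs L),
        tail = tail L,
        head = head L \<rparr>)"

section \<open>The subtrees of type X\<close>

text \<open>The condition \<open>part a (k + 1) < i\<close> renders $a_{k+1} \le i - 1$ without truncated subtraction.\<close>

definition X_root :: "nat \<Rightarrow> nat list \<Rightarrow> bool" where
  "X_root k a \<longleftrightarrow> 1 \<le> k \<and> a \<in> verts TB \<and>
     (\<exists>i. (\<forall>j \<in> {1..k}. part a j = i) \<and> part a (k + 1) < i)"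

definition X_tree :: "nat list \<Rightarrow> (nat list, edge) pre_digraph" where
  "X_tree a = (if out_degree TB a = 1 then subtree_at a else root_with_left_subtree a)"

definition X_subtree :: "nat \<Rightarrow> nat list \<Rightarrow> (nat list, edge) pre_digraph \<Rightarrow> bool" where
  "X_subtree k r S \<longleftrightarrow> X_root k r \<and> S = X_tree r"

definition num_paths :: "(nat list, edge) pre_digraph \<Rightarrow> nat list \<Rightarrow> nat \<Rightarrow> nat" where
  "num_paths S r l = card {p. \<exists>v. pre_digraph.apath S r p v \<and> length p = l}"

text \<open>The path count, taken in some subtree of type \<open>k\<close>; that the choice is immaterial
  is not built into the definition.\<close>

definition c :: "nat \<Rightarrow> nat \<Rightarrow> nat" where
  "c l k = (let (r, S) = (SOME (r, S). X_subtree k r S) in num_paths S r l)"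

end

theory Submission
  imports Defs
begin

text \<open>
  The vertices of the \<open>X\<^sub>k\<close> subtree rooted at \<open>r = (i, \<dots>, i, r\<^bsub>k+1\<^esub>, \<dots>)\<close> are exactly the
  partitions that agree with \<open>r\<close> beyond position \<open>k\<close> and whose first \<open>k\<close> parts are at least \<open>i\<close>: an
  edge leaving this set would have to increment part \<open>k + 1\<close>, which is too small for that except at \<open>r\<close>
  itself, and decrementing the last maximal part (the father map) stays inside the set until \<open>r\<close> is
  reached. Every edge raises the sum by one, so paths of length \<open>l\<close> correspond to such partitions of sum
  \<open>|r| + l\<close>; subtracting \<open>i\<close> from the first \<open>k\<close> parts turns them into partitions of \<open>l\<close> into at most
  \<open>k\<close> parts. Removing one from each of the \<open>i\<close> nonzero parts gives the recurrence.
\<close>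

section \<open>Partitions as antitone functions\<close>

lemma part_0 [simp]: "part a 0 = 0"
  by (simp add: part_def)

lemma part_beyond: "length a < j \<Longrightarrow> part a j = 0"
  by (simp add: part_def)

lemma part_Cons: "1 \<le> j \<Longrightarrow> part (x # xs) j = (if j = 1 then x else part xs (j - 1))"
  by (auto simp: part_def nth_Cons')

lemma part_append: "part (xs @ ys) j = (if j \<le> length xs then part xs j else part ys (j - length xs))"
  by (auto simp: part_def nth_append)

lemma part_drop: "1 \<le> j \<Longrightarrow> part (drop k a) j = part a (k + j)"
  by (auto simp: part_def)

lemma part_antimono:
  assumes "is_partition a" "1 \<le> i" "i \<le> j"
  shows "part a j \<le> part a i"
proof (cases "i = j \<or> length a < j")
  case True
  then show ?thesis by (auto simp: part_def)
next
  case False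
  then have "i - 1 < j - 1" "j - 1 < length a" using assms by auto
  then have "a ! (j - 1) \<le> a ! (i - 1)"
    using assms by (simp add: is_partition_def sorted_wrt_iff_nth_less)
  then show ?thesis using assms False by (auto simp: part_def)
qed

lemma part_pos_iff:
  assumes "is_partition a"
  shows "0 < part a j \<longleftrightarrow> 1 \<le> j \<and> j \<le> length a"
proof -
  have "0 < a ! (j - 1)" if "1 \<le> j" "j \<le> length a"
    using assms that by (simp add: is_partition_def)
  then show ?thesis by (auto simp: part_def)
qed

text \<open>Positivity marks exactly the indices up to the length, so \<open>part a\<close>
  determines the length as well as the entries.\<close>

lemma part_inject:
  assumes "is_partition a" "is_partition b" "part a = part b"
  shows "a = b"
proof (rule nth_equalityI)
  have "{j. 1 \<le> j \<and> j \<le> length a} = {j. 1 \<le> j \<and> j \<le> length b}"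
    using part_pos_iff[OF assms(1)] part_pos_iff[OF assms(2)] assms(3) by auto
  then have "{1..length a} = {1..length b}" by (simp add: atLeastAtMost_def atLeast_def atMost_def Collect_conj_eq)
  then show len: "length a = length b" by (metis card_atLeastAtMost diff_Suc_1)
  fix j assume "j < length a"
  then show "a ! j = b ! j"
    using len fun_cong[OF assms(3), of "Suc j"] by (simp add: part_def)
qed

lemma is_partitionI:
  assumes "\<And>j. 1 \<le> j \<Longrightarrow> part a (Suc j) \<le> part a j"
    and "a \<noteq> [] \<Longrightarrow> 0 < part a (length a)"
  shows "is_partition a"
proof -
  have anti: "part a j \<le> part a i" if "1 \<le> i" "i \<le> j" for i j
    using that(2)
  proof (induction j rule: dec_induct)
    case (step n)
    then show ?case using assms(1)[of n] that by auto
  qed simp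
  have nth: "a ! j = part a (Suc j)" if "j < length a" for j
    using that by (simp add: part_def)
  have "sorted_wrt (\<ge>) a"
    using anti by (auto simp: sorted_wrt_iff_nth_less nth)
  moreover have "0 < a ! j" if "j < length a" for j
  proof -
    have "part a (length a) \<le> part a (Suc j)" using that by (intro anti) auto
    moreover have "0 < part a (length a)" using that by (intro assms(2)) auto
    ultimately show ?thesis using nth[OF that] by simp
  qed
  ultimately show ?thesis by (auto simp: is_partition_def in_set_conv_nth)
qed

text \<open>The list is cut just before the first zero of \<open>f\<close> at a positive index;
  antitonicity keeps \<open>f\<close> zero from there on.\<close>

lemma ex_partition_part:
  assumes f0: "f 0 = 0" and anti: "\<And>j. 1 \<le> j \<Longrightarrow> f (Suc j) \<le> f j" and fin: "f (Suc M) = (0::nat)"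
  obtains a where "is_partition a" "part a = f"
proof -
  define N where "N = (LEAST n. f (Suc n) = 0)"
  define a where "a = map f [1..<Suc N]"
  have N0: "f (Suc N) = 0" unfolding N_def by (rule LeastI[of _ M]) (fact fin)
  have pos: "0 < f (Suc n)" if "n < N" for n
    using not_less_Least[of n "\<lambda>n. f (Suc n) = 0"] that by (simp add: N_def)
  have zero: "f j = 0" if "Suc N \<le> j" for j
    using that
  proof (induction j rule: dec_induct)
    case base show ?case by (fact N0)
  next
    case (step n) then show ?case using anti[of n] by simp
  qed
  have part: "part a = f"
  proof
    fix j show "part a j = f j"
      using f0 zero[of j] by (cases "j = 0") (auto simp: part_def a_def nth_append simp del: upt_Suc)
  qed
  moreover have "is_partition a"
  proof (rule is_partitionI)
    show "0 < part a (length a)" if "a \<noteq> []"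
    proof -
      have "length a = N" by (simp add: a_def del: upt_Suc)
      then show ?thesis using that pos[of "N - 1"] by (cases N) (auto simp: part)
    qed
  qed (simp add: part anti)
  ultimately show thesis by (rule that[rotated])
qed

section \<open>Incrementing one part: length, parts and sum\<close>

lemma length_incr: "length (incr i a) = max (length a) i"
  by (simp add: incr_def del: upt_Suc)

lemma part_incr:
  assumes "1 \<le> i"
  shows "part (incr i a) = (part a)(i := Suc (part a i))"
proof
  fix j
  show "part (incr i a) j = ((part a)(i := Suc (part a i))) j"
  proof (cases "1 \<le> j \<and> j \<le> max (length a) i")
    case True
    then have "incr i a ! (j - 1) = (if j = i then part a j + 1 else part a j)"
      unfolding incr_def by (subst nth_map) (auto simp: nth_upt simp del: upt_Suc)
    then show ?thesis using True by (simp add: part_def[of "incr i a"] length_incr)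
  next
    case False
    then show ?thesis using assms by (auto simp: part_def length_incr)
  qed
qed

text \<open>The range may extend past the end, so that lists of different lengths, such as
  \<open>a\<close> and \<open>incr i a\<close>, can be summed over a common range.\<close>

lemma sum_list_eq_sum_part:
  assumes "length a \<le> N"
  shows "sum_list a = (\<Sum>j = 1..N. part a j)"
proof -
  have "sum_list a = (\<Sum>j<length a. a ! j)"
    by (simp add: sum_list_sum_nth atLeast0LessThan)
  also have "\<dots> = (\<Sum>j<length a. part a (Suc j))"
    by (simp add: part_def)
  also have "\<dots> = (\<Sum>j<N. part a (Suc j))"
    using assms by (intro sum.mono_neutral_left) (auto simp: part_beyond)
  also have "\<dots> = (\<Sum>j = 1..N. part a j)"
    using sum.shift_bounds_Suc_ivl[of "part a" 0 N] by (simp add: atLeast0LessThan atLeastLessThanSuc_atLeastAtMost)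
  finally show ?thesis .
qed

lemma sum_list_incr:
  assumes "1 \<le> i"
  shows "sum_list (incr i a) = Suc (sum_list a)"
proof -
  let ?N = "max (length a) i"
  have i: "i \<in> {1..?N}" using assms by auto
  have "sum_list (incr i a) = (\<Sum>j = 1..?N. part a j + (if j = i then 1 else 0))"
    by (subst sum_list_eq_sum_part[of _ ?N])
       (auto simp: length_incr part_incr[OF assms] intro!: sum.cong)
  also have "\<dots> = Suc (sum_list a)"
    using i by (simp add: sum.distrib sum_list_eq_sum_part[of a ?N])
  finally show ?thesis .
qed

text \<open>Only the comparison with part \<open>i - 1\<close> is at risk; strictness there also
  excludes a gap beyond the end of \<open>a\<close>.\<close>

lemma is_partition_incr:
  assumes "is_partition a" "1 \<le> i" "i = 1 \<or> part a i < part a (i - 1)"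
  shows "is_partition (incr i a)"
proof (rule is_partitionI)
  fix j :: nat assume j: "1 \<le> j"
  then show "part (incr i a) (Suc j) \<le> part (incr i a) j"
    using assms part_antimono[OF assms(1) j, of "Suc j"] by (auto simp: part_incr)
next
  show "0 < part (incr i a) (length (incr i a))"
    using assms part_pos_iff[OF assms(1), of "length a"]
    by (auto simp: part_incr length_incr max_def)
qed

section \<open>Fathers and sons\<close>

text \<open>The copies of an upper bound form an initial segment of a decreasing list. The bound may
  fail to be attained, so that the claim passes to tails, and \<open>0 < m\<close> sets it apart
  from the default value 0 beyond the end.\<close>

lemma part_eq_bound_iff:
  assumes "sorted_wrt (\<ge>) xs" "\<forall>x\<in>set xs. x \<le> m" "0 < m" "1 \<le> j"
  shows "part xs j = m \<longleftrightarrow> j \<le> count_list xs m"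
  using assms
proof (induction xs arbitrary: j)
  case Nil
  then show ?case by (simp add: part_def)
next
  case (Cons x xs)
  have tail: "part xs i = m \<longleftrightarrow> i \<le> count_list xs m" if "1 \<le> i" for i
    using Cons that by auto
  show ?case
  proof (cases "x = m")
    case True
    then show ?thesis using tail[of "j - 1"] Cons.prems by (auto simp: part_Cons)
  next
    case False
    then have "m \<notin> set xs" using Cons.prems by force
    then show ?thesis
      using False tail[of "j - 1"] Cons.prems by (auto simp: part_Cons count_list_0_iff[THEN iffD2])
  qed
qed

lemma part_eq_first_iff:
  assumes "is_partition a" "a \<noteq> []" "1 \<le> j"
  shows "part a j = part a 1 \<longleftrightarrow> j \<le> top_mult a"
  unfolding top_mult_def
proof (rule part_eq_bound_iff)
  show "0 < part a 1" using assms by (simp add: part_pos_iff Suc_le_eq)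
  show "\<forall>x\<in>set a. x \<le> part a 1"
  proof
    fix x assume "x \<in> set a"
    then obtain i where "i < length a" "x = a ! i" by (auto simp: in_set_conv_nth)
    then show "x \<le> part a 1"
      using part_antimono[OF assms(1), of 1 "Suc i"] by (simp add: part_def)
  qed
qed (use assms in \<open>auto simp: is_partition_def\<close>)

lemma top_mult_pos:
  assumes "is_partition a" "a \<noteq> []"
  shows "1 \<le> top_mult a"
  using part_eq_first_iff[OF assms, of 1] by simp

lemma part_less_first_iff:
  assumes "is_partition a" "a \<noteq> []" "1 \<le> j"
  shows "part a j < part a 1 \<longleftrightarrow> top_mult a < j"
  using part_eq_first_iff[OF assms] part_antimono[OF assms(1), of 1 j] assms(3) by auto

text \<open>Describes an edge from its lower end, uniformly for left and right sons: the raised part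
  becomes the last of the maximal parts of the son, so the label can be read off from
  \<open>b\<close>.\<close>

lemma son_iff:
  assumes "is_partition a"
  shows "son a i b \<longleftrightarrow> b = incr i a \<and> is_partition b \<and> b \<noteq> [] \<and> i = top_mult b"
proof
  assume "son a i b"
  then show "b = incr i a \<and> is_partition b \<and> b \<noteq> [] \<and> i = top_mult b"
  proof cases
    case left
    have b: "is_partition b" unfolding left using assms by (intro is_partition_incr) auto
    have ne: "b \<noteq> []" using length_incr[of 1 a] left by auto
    have "part b 2 < part b 1"
      unfolding left using part_antimono[OF assms, of 1 2] by (simp add: part_incr)
    then have "top_mult b = 1"
      using part_less_first_iff[OF b ne, of 2] top_mult_pos[OF b ne] by simp
    then show ?thesis using left b ne by simp
  next
    case (right p)
    note first = part_eq_first_iff[OF assms right(3)] and less = part_less_first_iff[OF assms right(3)]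
    have p: "1 \<le> p" using top_mult_pos[OF assms right(3)] right by simp
    have "part a (p + 1) < part a (p + 1 - 1)" using right(5) by simp
    then have b: "is_partition b" unfolding right(2) using assms by (intro is_partition_incr) auto
    have ne: "b \<noteq> []" using length_incr[of "p + 1" a] right by auto
    have pb: "part b = (part a)(p + 1 := Suc (part a (p + 1)))" unfolding right(2) by (simp add: part_incr)
    have top: "part a p = part a 1" using first[OF p] right(4) by simp
    \<comment> \<open>The raised part joins the top block, which therefore ends at position
      \<open>p + 1\<close>.\<close>
    have "part b 1 = part a 1" using p by (simp add: pb)
    moreover have "part b (p + 1) = part a 1" using top right(5) by (simp add: pb)
    moreover have "part b (p + 2) < part a 1" using less[of "p + 2"] right(4) by (simp add: pb)
    ultimately have "top_mult b = p + 1"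
      using part_eq_first_iff[OF b ne, of "p + 1"] part_less_first_iff[OF b ne, of "p + 2"] by simp
    then show ?thesis using right b ne by simp
  qed
next
  assume "b = incr i a \<and> is_partition b \<and> b \<noteq> [] \<and> i = top_mult b"
  then have b: "b = incr i a" "is_partition b" "b \<noteq> []" "i = top_mult b" by blast+
  then have i: "1 \<le> i" using top_mult_pos[OF b(2,3)] by simp
  have pb: "part b = (part a)(i := Suc (part a i))" unfolding b(1) using part_incr[OF i] .
  show "son a i b"
  proof (cases "i = 1")
    case True
    then show ?thesis using b(1) son.left by simp
  next
    case False
    define p where "p = i - 1"
    have ip: "i = p + 1" "1 \<le> p" using False i by (auto simp: p_def)
    \<comment> \<open>Positions \<open>i - 1\<close> and \<open>i\<close> both lie in the top block
      of \<open>b\<close>; undoing the increment leaves the difference of one required for a right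
      son.\<close>
    have "part b p = part b 1" "part b i = part b 1"
      using b(4) ip part_eq_first_iff[OF b(2,3)] by auto
    then have eq: "part a p = part a 1" "part a p = part a (p + 1) + 1" using pb ip by auto
    then have ne: "a \<noteq> []" by (auto simp: part_def)
    have "top_mult a = p"
      using part_eq_first_iff[OF assms ne, of p] part_less_first_iff[OF assms ne, of "p + 1"] eq ip
      by simp
    then show ?thesis using son.right[OF ne _ eq(2)] b(1) ip by simp
  qed
qed

lemma sonD:
  assumes "is_partition a" "son a i b"
  shows "b = incr i a" "is_partition b" "b \<noteq> []" "i = top_mult b" "1 \<le> i"
    "part b = (part a)(i := Suc (part a i))"
proof -
  show b: "b = incr i a" "is_partition b" "b \<noteq> []" "i = top_mult b"
    using assms(2) unfolding son_iff[OF assms(1)] by blast+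
  show "1 \<le> i" using top_mult_pos[OF b(2,3)] unfolding b(4) .
  then show "part b = (part a)(i := Suc (part a i))" unfolding b(1) by (rule part_incr)
qed

text \<open>The label is \<open>top_mult b\<close>; undoing this one increment recovers every part
  of the father.\<close>

lemma son_unique_father:
  assumes "is_partition a" "is_partition a'" "son a i b" "son a' i' b"
  shows "a = a' \<and> i = i'"
proof -
  note b = sonD[OF assms(1,3)] and b' = sonD[OF assms(2,4)]
  have i: "i = i'" using b(4) b'(4) by (rule trans[OF _ sym])
  have "part a j = part a' j" for j
    using fun_cong[OF b(6), of j] fun_cong[OF b'(6), of j] i by (auto split: if_splits)
  then have "part a = part a'" by blast
  then show ?thesis using part_inject[OF assms(1,2)] i by blast
qed

text \<open>Lowering the last maximal part keeps the sequence decreasing, since the next part is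
  strictly smaller. A part that drops to 0 disappears from the list.\<close>

lemma ex_father:
  assumes "is_partition b" "b \<noteq> []"
  obtains a where "is_partition a" "part a = (part b)(top_mult b := part b (top_mult b) - 1)"
    "son a (top_mult b) b"
proof -
  let ?i = "top_mult b"
  let ?f = "(part b)(?i := part b ?i - 1)"
  note i = top_mult_pos[OF assms]
  have first: "0 < part b 1" using assms by (simp add: part_pos_iff Suc_le_eq)
  have top: "part b ?i = part b 1" using part_eq_first_iff[OF assms i] by simp
  obtain a where a: "is_partition a" "part a = ?f"
  proof (rule ex_partition_part)
    show "?f 0 = 0" using i by simp
    show "?f (Suc (length b + ?i)) = 0" using i by (simp add: part_beyond)
    show "?f (Suc j) \<le> ?f j" if "1 \<le> j" for j
      using part_antimono[OF assms(1) that, of "Suc j"] part_less_first_iff[OF assms, of "Suc j"] top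
      by auto
  qed
  have "incr ?i a = b"
  proof (rule part_inject)
    show eq: "part (incr ?i a) = part b" using a i first top by (auto simp: part_incr)
    show "is_partition (incr ?i a)"
    proof (rule is_partition_incr)
      have "part b (?i - 1) = part b 1" if "?i \<noteq> 1"
        using part_eq_first_iff[OF assms, of "?i - 1"] that i by simp
      then show "?i = 1 \<or> part a ?i < part a (?i - 1)" using a(2) i first top
        by (cases "?i = 1") (auto simp del: One_nat_def)
    qed (use a i in auto)
  qed (fact assms)
  then have "son a ?i b" using son_iff[OF a(1)] assms by simp
  then show thesis using a that by blast
qed

lemma sum_list_son:
  assumes "is_partition a" "son a i b"
  shows "sum_list b = Suc (sum_list a)"
  unfolding sonD(1)[OF assms] using sonD(5)[OF assms] by (rule sum_list_incr)

text \<open>Passing to fathers lowers the sum, so the descent from any partition ends at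
  \<open>[]\<close>.\<close>

lemma mem_TB_nodes_iff: "a \<in> TB_nodes \<longleftrightarrow> is_partition a"
proof
  show "a \<in> TB_nodes \<Longrightarrow> is_partition a"
  proof (induction rule: TB_nodes.induct)
    case root then show ?case by (simp add: is_partition_def)
  next
    case (son a i b) then show ?case using son_iff by blast
  qed
  show "is_partition a \<Longrightarrow> a \<in> TB_nodes"
  proof (induction "sum_list a" arbitrary: a rule: less_induct)
    case less
    show ?case
    proof (cases "a = []")
      case True then show ?thesis by (simp add: TB_nodes.root)
    next
      case False
      obtain b where b: "is_partition b" "son b (top_mult a) a"
        using ex_father[OF less.prems False] by blast
      then show ?thesis using less.hyps[of b] sum_list_son[OF b] TB_nodes.son by auto
    qed
  qed
qed

section \<open>Paths in graded trees\<close>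

text \<open>Heights grow strictly along a walk, so no vertex repeats: every walk is a path.\<close>

lemma (in wf_digraph) awalk_graded:
  assumes graded: "\<And>e. e \<in> arcs G \<Longrightarrow> h (head G e) = Suc (h (tail G e))"
    and "awalk u p v"
  shows "distinct (awalk_verts u p) \<and> (\<forall>x \<in> set (awalk_verts u p). h u \<le> h x) \<and> h v = h u + length p"
  using assms(2)
proof (induction p arbitrary: u)
  case Nil
  then show ?case by (auto simp: awalk_Nil_iff)
next
  case (Cons e p)
  then have e: "e \<in> arcs G" "u = tail G e" "awalk (head G e) p v" by (auto simp: awalk_Cons_iff)
  have "h u < h x" if "x \<in> set (awalk_verts (head G e) p)" for x
    using Cons.IH[OF e(3)] graded[OF e(1)] e(2) that by auto
  then show ?case using Cons.IH[OF e(3)] graded[OF e(1)] e(2) by auto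
qed

text \<open>Following the unique incoming arcs back to \<open>r\<close> gives each vertex exactly
  one path from \<open>r\<close>, of length its height above \<open>r\<close>. Sending a path to its
  end is then a bijection onto a level.\<close>

lemma (in wf_digraph) card_apaths_graded_tree:
  assumes graded: "\<And>e. e \<in> arcs G \<Longrightarrow> h (head G e) = Suc (h (tail G e))"
    and father: "\<And>v. v \<in> verts G \<Longrightarrow> v \<noteq> r \<Longrightarrow> \<exists>!e. e \<in> arcs G \<and> head G e = v"
    and root: "r \<in> verts G"
  shows "card {p. \<exists>v. apath r p v \<and> length p = l} = card {v \<in> verts G. h v = h r + l}"
proof -
  have apath_iff: "apath r p v \<longleftrightarrow> awalk r p v" for p v
    unfolding apath_def using awalk_graded[of h, OF graded] by blast
  \<comment> \<open>Every other vertex has a father of smaller height, so the descent can only stop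
    at \<open>r\<close>.\<close>
  have min: "h r \<le> h v" if "v \<in> verts G" for v
    using that
  proof (induction "h v" arbitrary: v rule: less_induct)
    case less
    show ?case
    proof (cases "v = r")
      case False
      then obtain e where e: "e \<in> arcs G" "head G e = v" using father less.prems by blast
      then show ?thesis using less.hyps[of "tail G e"] graded[OF e(1)] by auto
    qed simp
  qed
  have ex1: "\<exists>!p. awalk r p v" if "v \<in> verts G" "h v = h r + n" for v n
    using that
  proof (induction n arbitrary: v)
    case 0
    have "v = r"
    proof (rule ccontr)
      assume "v \<noteq> r"
      then obtain e where e: "e \<in> arcs G" "head G e = v" using father 0 by blast
      then show False using graded[OF e(1)] min[of "tail G e"] 0 by auto
    qed
    moreover have "p = []" if "awalk r p r" for p
      using awalk_graded[of h, OF graded that] by simp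
    ultimately show ?case using root by (auto simp: awalk_Nil_iff intro!: ex1I[of _ "[]"])
  next
    case (Suc n)
    then have "v \<noteq> r" by auto
    from father[OF Suc.prems(1) this] obtain e
      where e: "e \<in> arcs G" "head G e = v"
        and uniq: "\<And>e'. e' \<in> arcs G \<Longrightarrow> head G e' = v \<Longrightarrow> e' = e" by blast
    obtain p where p: "awalk r p (tail G e)" "\<And>q. awalk r q (tail G e) \<Longrightarrow> q = p"
      using Suc.IH[of "tail G e"] graded[OF e(1)] Suc.prems e by auto
    have "awalk r (p @ [e]) v"
      using awalk_appendI[OF p(1) arc_implies_awalk[OF e(1)]] e by simp
    \<comment> \<open>The last arc of a walk to \<open>v\<close> must be the unique incoming arc
      \<open>e\<close>; what precedes it is the unique walk to the tail of \<open>e\<close>.\<close>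
    moreover have "q = p @ [e]" if q: "awalk r q v" for q
    proof (cases q rule: rev_cases)
      case Nil
      then show ?thesis using q \<open>v \<noteq> r\<close> by (simp add: awalk_Nil_iff)
    next
      case (snoc q' e')
      then have "awalk r q' (awlast r q')" "awalk (awlast r q') [e'] v" using q by auto
      then have "awalk r q' (tail G e')" "e' \<in> arcs G" "head G e' = v"
        by (auto simp: awalk_Cons_iff awalk_Nil_iff)
      then show ?thesis using uniq p(2) snoc by blast
    qed
    ultimately show ?case by blast
  qed
  have "bij_betw (awlast r) {p. \<exists>v. apath r p v \<and> length p = l} {v \<in> verts G. h v = h r + l}"
  proof (rule bij_betw_imageI)
    show "inj_on (awlast r) {p. \<exists>v. apath r p v \<and> length p = l}"
    proof (rule inj_onI)
      fix p q
      assume "p \<in> {p. \<exists>v. apath r p v \<and> length p = l}" "q \<in> {p. \<exists>v. apath r p v \<and> length p = l}"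
        and eq: "awlast r p = awlast r q"
      then obtain v w where p: "awalk r p v" and q: "awalk r q w" by (auto simp: apath_iff)
      then have "w = v" using eq by auto
      moreover have "v \<in> verts G" using p by auto
      ultimately show "p = q"
        using ex1[of v "length p"] awalk_graded[of h, OF graded p] p q by blast
    qed
    show "awlast r ` {p. \<exists>v. apath r p v \<and> length p = l} = {v \<in> verts G. h v = h r + l}"
    proof (intro equalityI subsetI)
      fix v assume v: "v \<in> {v \<in> verts G. h v = h r + l}"
      then obtain p where p: "awalk r p v" using ex1 by blast
      then have "length p = l" using awalk_graded[of h, OF graded p] v by simp
      then show "v \<in> awlast r ` {p. \<exists>v. apath r p v \<and> length p = l}"
        using p by (auto simp: apath_iff image_iff)
    next
      fix v assume "v \<in> awlast r ` {p. \<exists>v. apath r p v \<and> length p = l}"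
      then obtain p where p: "awalk r p v" "length p = l" by (auto simp: apath_iff)
      then show "v \<in> {v \<in> verts G. h v = h r + l}"
        using awalk_graded[of h, OF graded p(1)] by auto
    qed
  qed
  then show ?thesis by (rule bij_betw_same_card)
qed

section \<open>The nodes of an X subtree\<close>

lemma TB_simps:
  "verts TB = {a. is_partition a}"
  "arcs TB = {(a, i, b). is_partition a \<and> son a i b}"
  "tail TB = (\<lambda>(a, i, b). a)"
  "head TB = (\<lambda>(a, i, b). b)"
  by (auto simp: TB_def mem_TB_nodes_iff)

lemma wf_digraph_TB: "wf_digraph TB"
  by unfold_locales (auto simp: TB_simps dest: sonD(2))

lemma TB_adj_iff: "a \<rightarrow>\<^bsub>TB\<^esub> b \<longleftrightarrow> is_partition a \<and> (\<exists>i. son a i b)"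
  by (force simp: arcs_ends_def arc_to_ends_def TB_simps)

text \<open>For \<open>X_root k r\<close>, \<open>part r 1\<close> is the common value of the first
  \<open>k\<close> parts of \<open>r\<close>. Bounding part \<open>k\<close> of a partition from
  below bounds all earlier parts too.\<close>

definition X_nodes :: "nat \<Rightarrow> nat list \<Rightarrow> nat list set" where
  "X_nodes k r = {b. is_partition b \<and> (\<forall>j>k. part b j = part r j) \<and> part r 1 \<le> part b k}"

text \<open>Replaces the witness \<open>i\<close> by \<open>part r 1\<close> from here on.\<close>

lemma X_rootD:
  assumes "X_root k r"
  shows "1 \<le> k" "is_partition r" "1 \<le> j \<Longrightarrow> j \<le> k \<Longrightarrow> part r j = part r 1"
    "part r (Suc k) < part r 1"
proof -
  obtain i where i: "\<forall>j\<in>{1..k}. part r j = i" "part r (k + 1) < i"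
    using assms by (auto simp: X_root_def)
  show k: "1 \<le> k" and "is_partition r" using assms by (auto simp: X_root_def TB_simps)
  have 1: "part r 1 = i" using i k by simp
  show "1 \<le> j \<Longrightarrow> j \<le> k \<Longrightarrow> part r j = part r 1" using 1 i by simp
  show "part r (Suc k) < part r 1" using 1 i by simp
qed

context
  fixes k r assumes X: "X_root k r"
begin

lemma X_nodesD:
  assumes "b \<in> X_nodes k r"
  shows "is_partition b" "k < j \<Longrightarrow> part b j = part r j" "1 \<le> j \<Longrightarrow> j \<le> k \<Longrightarrow> part r 1 \<le> part b j"
proof -
  show b: "is_partition b" and "k < j \<Longrightarrow> part b j = part r j" using assms by (auto simp: X_nodes_def)
  show "part r 1 \<le> part b j" if "1 \<le> j" "j \<le> k"
    using part_antimono[OF b that] assms by (simp add: X_nodes_def)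
qed

lemma root_in_X_nodes: "r \<in> X_nodes k r"
  using X_rootD(1,2)[OF X] X_rootD(3)[OF X, of k] by (auto simp: X_nodes_def)

lemma X_nodes_not_Nil: "b \<in> X_nodes k r \<Longrightarrow> b \<noteq> []"
  using X_nodesD(3)[of b 1] X_rootD(1,2,4)[OF X] by (auto simp: part_def)

text \<open>Otherwise the first \<open>k\<close> parts of \<open>b\<close> are squeezed between
  \<open>part r 1\<close> and \<open>part b 1\<close>, which forces \<open>b = r\<close>.\<close>

lemma X_nodes_first_gt:
  assumes b: "b \<in> X_nodes k r" "b \<noteq> r"
  shows "part r 1 < part b 1"
proof (rule ccontr)
  assume "\<not> part r 1 < part b 1"
  moreover have "part r 1 \<le> part b j" "part b j \<le> part b 1" if "1 \<le> j" "j \<le> k" for j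
    using X_nodesD[OF b(1)] that part_antimono[of b 1 j] by auto
  ultimately have first: "part b j = part r 1" if "1 \<le> j" "j \<le> k" for j
    using that by (meson le_antisym le_trans not_less)
  have "part b j = part r j" for j
  proof (cases "1 \<le> j \<and> j \<le> k")
    case True
    then show ?thesis using first[of j] X_rootD(3)[OF X, of j] by metis
  next
    case False
    then show ?thesis using X_nodesD(2)[OF b(1)] by (cases "j = 0") auto
  qed
  then have "part b = part r" by blast
  then show False using part_inject[of b r] X_nodesD(1)[OF b(1)] X_rootD(2)[OF X] b(2) by blast
qed

text \<open>The first part has grown past \<open>part r 1\<close> while part \<open>k + 1\<close>
  still lies below it, so the top block ends by position \<open>k\<close>.\<close>

lemma X_nodes_top_mult_le:
  assumes b: "b \<in> X_nodes k r" "b \<noteq> r"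
  shows "top_mult b \<le> k"
proof -
  have "part b (Suc k) < part b 1"
    using X_nodes_first_gt[OF b] X_nodesD(2)[OF b(1), of "Suc k"] X_rootD(1,2,4)[OF X] by simp
  then show ?thesis
    using part_less_first_iff[OF X_nodesD(1)[OF b(1)] X_nodes_not_Nil[OF b(1)], of "Suc k"] by simp
qed

lemma left_son_in_X_nodes: "incr 1 r \<in> X_nodes k r"
  using X_rootD(1,2)[OF X] X_rootD(3)[OF X, of k] is_partition_incr[of r 1] by (auto simp: X_nodes_def part_incr)

text \<open>Only the label \<open>k + 1\<close> could lead out of the set. It would need
  \<open>part a k = part r (k + 1) + 1\<close>, which is at most \<open>part r 1\<close> and hence
  too small.\<close>

lemma X_nodes_son:
  assumes a: "a \<in> X_nodes k r" "a \<noteq> r" and son: "son a i b"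
  shows "b \<in> X_nodes k r"
proof -
  note pa = X_nodesD(1)[OF a(1)]
  note b = sonD(5,6)[OF pa son]
  have pb: "is_partition b" using sonD(2)[OF pa son] .
  have "i \<le> k"
    using son
  proof cases
    case left
    then show ?thesis using X_rootD(1,2,4)[OF X] by simp
  next
    case (right p)
    have "p \<noteq> k"
    proof
      assume p: "p = k"
      have "part a k = part a 1"
        using part_eq_first_iff[OF pa right(3), of k] X_rootD(1,2,4)[OF X] right p by simp
      then show False
        using X_nodes_first_gt[OF a] right p X_nodesD(2)[OF a(1), of "k + 1"] X_rootD(1,2,4)[OF X] by simp
    qed
    then show ?thesis using X_nodes_top_mult_le[OF a] right by simp
  qed
  then show ?thesis using b pb a(1) by (auto simp: X_nodes_def)
qed

text \<open>The part to be lowered is among the first \<open>k\<close> and has the top value, which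
  exceeds \<open>part r 1\<close>; so it stays at least \<open>part r 1\<close>.\<close>

lemma X_nodes_father:
  assumes b: "b \<in> X_nodes k r" "b \<noteq> r" and a: "is_partition a" "son a i b"
  shows "a \<in> X_nodes k r"
proof -
  note i = sonD(4)[OF a]
  then have "i \<le> k" using X_nodes_top_mult_le[OF b] by simp
  moreover have "part b i = part b 1"
    using i part_eq_first_iff[OF X_nodesD(1)[OF b(1)] X_nodes_not_Nil[OF b(1)], of i] sonD(5,6)[OF a] by simp
  then have "part r 1 \<le> part a i" using X_nodes_first_gt[OF b] sonD(5,6)[OF a] by simp
  ultimately show ?thesis using b(1) sonD(5,6)[OF a] a by (auto simp: X_nodes_def split: if_splits)
qed

text \<open>A label above \<open>k\<close> changes a part that must stay fixed. Among the first
  \<open>k\<close> parts of \<open>r\<close>, all equal, only the first can be raised without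
  breaking the order.\<close>

lemma son_root_in_X_nodes:
  assumes "son r i b" "b \<in> X_nodes k r"
  shows "i = 1"
proof (rule ccontr)
  assume "i \<noteq> 1"
  note b = sonD(5,6)[OF X_rootD(2)[OF X] assms(1)]
  have "i \<le> k" using X_nodesD(2)[OF assms(2), of i] b by fastforce
  then have i: "1 \<le> i - 1" "i - 1 \<le> i" "i - 1 \<noteq> i" "i - 1 \<le> k" using \<open>i \<noteq> 1\<close> b(1) by auto
  have "part r i = part r 1" "part r (i - 1) = part r 1"
    using X_rootD(3)[OF X b(1) \<open>i \<le> k\<close>] X_rootD(3)[OF X i(1,4)] by auto
  then show False
    using part_antimono[OF X_nodesD(1)[OF assms(2)] i(1,2)] i(3) b(2) by simp
qed

section \<open>Identifying the X subtree with an induced subgraph\<close>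

text \<open>Sons of nodes other than \<open>r\<close> stay in the set; conversely, fathers stay in
  it until \<open>r\<close> is reached, and \<open>r\<close> can only be left there by its left
  edge.\<close>

lemma reachable_left_son: "{b. incr 1 r \<rightarrow>\<^sup>*\<^bsub>TB\<^esub> b} = X_nodes k r - {r}"
proof (intro equalityI subsetI)
  interpret TB: wf_digraph TB by (rule wf_digraph_TB)
  fix b assume "b \<in> {b. incr 1 r \<rightarrow>\<^sup>*\<^bsub>TB\<^esub> b}"
  then have "incr 1 r \<rightarrow>\<^sup>*\<^bsub>TB\<^esub> b" by simp
  \<comment> \<open>The sum inequality is carried along to keep the walk away from \<open>r\<close>,
    where closure under sons can fail.\<close>
  then have "b \<in> X_nodes k r \<and> sum_list r < sum_list b"
  proof (induction rule: TB.reachable_induct)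
    case base
    show ?case using left_son_in_X_nodes sum_list_incr[of 1 r] by simp
  next
    case (step x y)
    then obtain i where "is_partition x" "son x i y" by (auto simp: TB_adj_iff)
    then show ?case using step X_nodes_son[of x i y] sum_list_son[of x i y] by force
  qed
  then show "b \<in> X_nodes k r - {r}" by auto
next
  interpret TB: wf_digraph TB by (rule wf_digraph_TB)
  fix b assume "b \<in> X_nodes k r - {r}"
  then have "incr 1 r \<rightarrow>\<^sup>*\<^bsub>TB\<^esub> b"
  proof (induction "sum_list b" arbitrary: b rule: less_induct)
    case less
    then have b: "b \<in> X_nodes k r" "b \<noteq> r" by auto
    obtain a i where a: "is_partition a" "son a i b"
      using ex_father[OF X_nodesD(1)[OF b(1)] X_nodes_not_Nil[OF b(1)]] by blast
    note aX = X_nodes_father[OF b a]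
    show ?case
    proof (cases "a = r")
      case True
      then have "b = incr 1 r" using son_root_in_X_nodes[of i b] sonD(1)[OF a] a b by simp
      then show ?thesis using X_nodesD(1)[OF b(1)] by (simp add: TB.reachable_refl TB_simps)
    next
      case False
      then have "incr 1 r \<rightarrow>\<^sup>*\<^bsub>TB\<^esub> a" using less.hyps[of a] aX sum_list_son[OF a] by simp
      moreover have "a \<rightarrow>\<^bsub>TB\<^esub> b" using a by (auto simp: TB_adj_iff)
      ultimately show ?thesis by (rule TB.reachable_adj_trans)
    qed
  qed
  then show "b \<in> {b. incr 1 r \<rightarrow>\<^sup>*\<^bsub>TB\<^esub> b}" by simp
qed

lemma reachable_single_son:
  assumes "out_degree TB r = 1"
  shows "{b. r \<rightarrow>\<^sup>*\<^bsub>TB\<^esub> b} = X_nodes k r"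
proof -
  interpret TB: wf_digraph TB by (rule wf_digraph_TB)
  have r: "is_partition r" using X_rootD(1,2,4)[OF X] by simp
  have left: "(r, 1, incr 1 r) \<in> out_arcs TB r"
    using r son.left[of r] by (simp add: out_arcs_def TB_simps)
  obtain e where "out_arcs TB r = {e}"
    using assms by (auto simp: out_degree_def card_1_singleton_iff)
  then have out: "out_arcs TB r = {(r, 1, incr 1 r)}" using left by simp
  have adj: "r \<rightarrow>\<^bsub>TB\<^esub> b \<longleftrightarrow> b = incr 1 r" for b
  proof
    assume "r \<rightarrow>\<^bsub>TB\<^esub> b"
    then obtain i where "(r, i, b) \<in> out_arcs TB r"
      using r by (auto simp: TB_adj_iff out_arcs_def TB_simps)
    then show "b = incr 1 r" unfolding out by simp
  next
    show "b = incr 1 r \<Longrightarrow> r \<rightarrow>\<^bsub>TB\<^esub> b" using r son.left[of r] by (auto simp: TB_adj_iff)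
  qed
  have "r \<rightarrow>\<^sup>*\<^bsub>TB\<^esub> b \<longleftrightarrow> b = r \<or> incr 1 r \<rightarrow>\<^sup>*\<^bsub>TB\<^esub> b" for b
    using adj TB.converse_reachable_cases[of r b] TB.adj_reachable_trans[of r "incr 1 r" b]
      TB.reachable_refl[of r] r TB_simps(1) by (metis mem_Collect_eq)
  then show ?thesis using reachable_left_son root_in_X_nodes by auto
qed

text \<open>A right son of \<open>r\<close> lies outside \<open>X_nodes k r\<close>, so the induced
  subgraph omits exactly that branch and both cases of \<open>X_tree\<close> take the same
  form.\<close>

lemma X_tree_eq:
  "X_tree r = TB \<restriction> X_nodes k r"
proof (cases "out_degree TB r = 1")
  case True
  then show ?thesis using reachable_single_son by (simp add: X_tree_def subtree_at_def)
next
  case False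
  have "arcs (TB \<restriction> X_nodes k r) = insert (r, 1, incr 1 r) (arcs (TB \<restriction> (X_nodes k r - {r})))"
  proof (intro equalityI subsetI)
    fix e assume "e \<in> arcs (TB \<restriction> X_nodes k r)"
    then obtain a i b where e: "e = (a, i, b)" "is_partition a" "son a i b" "a \<in> X_nodes k r" "b \<in> X_nodes k r"
      by (auto simp: TB_simps induce_subgraph_def)
    \<comment> \<open>No edge inside the set enters \<open>r\<close>: first parts never decrease
      along an edge, and a loop at \<open>r\<close> contradicts the growth of the sum.\<close>
    have "b \<noteq> r"
    proof
      assume "b = r"
      have "part r 1 < part a 1 \<or> a = r" using X_nodes_first_gt e by blast
      moreover have "part a 1 \<le> part b 1" using sonD(6)[OF e(2,3)] by simp
      ultimately show False using \<open>b = r\<close> sum_list_son[OF e(2,3)] by auto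
    qed
    then show "e \<in> insert (r, 1, incr 1 r) (arcs (TB \<restriction> (X_nodes k r - {r})))"
      using e son_root_in_X_nodes[of i b] sonD(1)[of r i b] by (auto simp: TB_simps induce_subgraph_def)
  next
    fix e assume "e \<in> insert (r, 1, incr 1 r) (arcs (TB \<restriction> (X_nodes k r - {r})))"
    then show "e \<in> arcs (TB \<restriction> X_nodes k r)"
      using root_in_X_nodes left_son_in_X_nodes X_rootD(2)[OF X] son.left[of r]
      by (auto simp: TB_simps induce_subgraph_def)
  qed
  then show ?thesis
    using False reachable_left_son root_in_X_nodes
    by (auto simp: X_tree_def root_with_left_subtree_def subtree_at_def Let_def induce_subgraph_def)
qed

text \<open>The subtree is a tree graded by \<open>sum_list\<close>, since the father of each node
  other than \<open>r\<close> stays inside.\<close>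

lemma num_paths_X_tree:
  "num_paths (X_tree r) r l = card {b \<in> X_nodes k r. sum_list b = sum_list r + l}"
proof -
  interpret TB: wf_digraph TB by (rule wf_digraph_TB)
  interpret S: wf_digraph "TB \<restriction> X_nodes k r" by (rule TB.wellformed_induce_subgraph)
  have arcs: "arcs (TB \<restriction> X_nodes k r) =
      {(a, i, b). is_partition a \<and> son a i b \<and> a \<in> X_nodes k r \<and> b \<in> X_nodes k r}"
    by (auto simp: TB_simps induce_subgraph_def)
  have "card {p. \<exists>v. S.apath r p v \<and> length p = l} =
      card {b \<in> verts (TB \<restriction> X_nodes k r). sum_list b = sum_list r + l}"
  proof (rule S.card_apaths_graded_tree)
    show "sum_list (head (TB \<restriction> X_nodes k r) e) = Suc (sum_list (tail (TB \<restriction> X_nodes k r) e))"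
      if e: "e \<in> arcs (TB \<restriction> X_nodes k r)" for e
    proof -
      obtain a i b where "e = (a, i, b)" "is_partition a" "son a i b"
        using e by (auto simp: TB_simps)
      then show ?thesis using sum_list_son[of a i b] by (simp add: TB_simps)
    qed
    show "\<exists>!e. e \<in> arcs (TB \<restriction> X_nodes k r) \<and> head (TB \<restriction> X_nodes k r) e = b"
      if "b \<in> verts (TB \<restriction> X_nodes k r)" "b \<noteq> r" for b
    proof -
      from that have b: "b \<in> X_nodes k r" "b \<noteq> r" by auto
      obtain a i where a: "is_partition a" "son a i b"
        using ex_father[OF X_nodesD(1)[OF b(1)] X_nodes_not_Nil[OF b(1)]] by blast
      show ?thesis
      proof (rule ex1I[of _ "(a, i, b)"])
        show "(a, i, b) \<in> arcs (TB \<restriction> X_nodes k r) \<and> head (TB \<restriction> X_nodes k r) (a, i, b) = b"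
          using a X_nodes_father[OF b a] b by (simp add: arcs TB_simps)
        fix e assume "e \<in> arcs (TB \<restriction> X_nodes k r) \<and> head (TB \<restriction> X_nodes k r) e = b"
        then obtain a' i' where e: "e = (a', i', b)" "is_partition a'" "son a' i' b"
          by (auto simp: arcs TB_simps)
        then show "e = (a, i, b)" using son_unique_father[OF a(1) e(2) a(2) e(3)] by simp
      qed
    qed
  qed (simp add: root_in_X_nodes)
  then show ?thesis by (simp add: num_paths_def X_tree_eq)
qed

end

section \<open>Decreasing lists of fixed length\<close>

text \<open>Zero entries are allowed, so this encodes the partitions of \<open>l\<close> into at most \<open>k\<close> parts.\<close>

definition desc_lists :: "nat \<Rightarrow> nat \<Rightarrow> nat list set" where
  "desc_lists l k = {xs. length xs = k \<and> sorted_wrt (\<ge>) xs \<and> sum_list xs = l}"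

lemma finite_desc_lists: "finite (desc_lists l k)"
proof (rule finite_subset)
  show "desc_lists l k \<subseteq> {xs. set xs \<subseteq> {..l} \<and> length xs = k}"
    using member_le_sum_list by (auto simp: desc_lists_def)
qed (simp add: finite_lists_length_eq)

lemma card_desc_lists_0: "card (desc_lists 0 k) = 1"
proof -
  have "desc_lists 0 k = {replicate k 0}"
    by (auto simp: desc_lists_def sorted_wrt_iff_nth_less sum_list_replicate intro!: replicate_eqI)
  then show ?thesis by simp
qed

lemma desc_lists_Suc_0: "desc_lists (Suc l) 0 = {}"
  by (auto simp: desc_lists_def)

lemma sum_list_map_add: "sum_list (map ((+) m) xs) = length xs * m + sum_list xs" for m :: nat
  by (induction xs) auto

lemma sum_list_map_Suc: "sum_list (map Suc xs) = length xs + sum_list xs"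
  by (induction xs) auto

section \<open>Partitions of given length and the recurrence\<close>

text \<open>Removing one from each of the \<open>k\<close> positive parts lowers the sum by
  \<open>k\<close> and may create zeros; \<open>k \<le> n\<close> keeps \<open>n - k\<close> from
  being truncated.\<close>

lemma exact_length_partitions_eq:
  assumes "k \<le> n"
  shows "{a \<in> L_B n. length a = k} = map Suc ` desc_lists (n - k) k"
proof (intro equalityI subsetI)
  fix a assume "a \<in> {a \<in> L_B n. length a = k}"
  then have a: "length a = k" "is_partition a" "sum_list a = n" by (auto simp: L_B_def)
  define xs where "xs = map (\<lambda>x. x - 1) a"
  have eq: "a = map Suc xs"
    using a(2) by (auto simp: xs_def is_partition_def map_idI[symmetric])
  have "sorted_wrt (\<ge>) xs" using a(2) unfolding eq by (simp add: is_partition_def sorted_wrt_map)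
  moreover have "sum_list xs = n - k" using a eq sum_list_map_Suc[of xs] by simp
  ultimately show "a \<in> map Suc ` desc_lists (n - k) k"
    using eq a(1) by (auto simp: desc_lists_def)
next
  fix a assume "a \<in> map Suc ` desc_lists (n - k) k"
  then show "a \<in> {a \<in> L_B n. length a = k}"
    using assms by (auto simp: desc_lists_def L_B_def is_partition_def sorted_wrt_map sum_list_map_Suc)
qed

lemma card_exact_length_partitions:
  assumes "k \<le> n"
  shows "card {a \<in> L_B n. length a = k} = card (desc_lists (n - k) k)"
  unfolding exact_length_partitions_eq[OF assms]
  by (intro card_image inj_onI) (simp add: inj_map_eq_map)

lemma length_le_of_mem_L_B: "a \<in> L_B n \<Longrightarrow> length a \<le> n"
proof -
  have "length xs \<le> sum_list xs" if "\<forall>x\<in>set xs. 0 < x" for xs :: "nat list"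
    using that by (induction xs) auto
  then show "a \<in> L_B n \<Longrightarrow> length a \<le> n" by (auto simp: L_B_def is_partition_def)
qed

text \<open>Split by whether the last entry is zero.\<close>

lemma card_desc_lists_Suc:
  "card (desc_lists l (Suc k)) = card (desc_lists l k) +
     (if Suc k \<le> l then card (desc_lists (l - Suc k) (Suc k)) else 0)"
proof -
  let ?Z = "(\<lambda>xs. xs @ [0]) ` desc_lists l k" and ?P = "{a \<in> L_B l. length a = Suc k}"
  have "desc_lists l (Suc k) = ?Z \<union> ?P"
  proof (intro equalityI subsetI)
    fix xs assume xs: "xs \<in> desc_lists l (Suc k)"
    then obtain ys y where ys: "xs = ys @ [y]"
      by (cases xs rule: rev_cases) (auto simp: desc_lists_def)
    show "xs \<in> ?Z \<union> ?P"
    proof (cases "y = 0")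
      case True
      then have "ys \<in> desc_lists l k" using xs ys by (auto simp: desc_lists_def sorted_wrt_append)
      then show ?thesis using ys True by auto
    next
      case False
      \<comment> \<open>A nonzero last entry makes all entries positive, because the list is
        decreasing.\<close>
      then have "xs \<in> ?P"
        using xs ys by (fastforce simp: desc_lists_def L_B_def is_partition_def sorted_wrt_append)
      then show ?thesis ..
    qed
  next
    fix xs assume "xs \<in> ?Z \<union> ?P"
    then show "xs \<in> desc_lists l (Suc k)"
      by (auto simp: desc_lists_def L_B_def is_partition_def sorted_wrt_append)
  qed
  moreover have "?Z \<inter> ?P = {}" by (auto simp: L_B_def is_partition_def)
  moreover have "finite ?P"
    by (rule finite_subset[OF _ finite_desc_lists[of l "Suc k"]]) (auto simp: desc_lists_def L_B_def is_partition_def)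
  moreover have "card ?Z = card (desc_lists l k)" by (intro card_image inj_onI) simp
  moreover have "card ?P = (if Suc k \<le> l then card (desc_lists (l - Suc k) (Suc k)) else 0)"
  proof (cases "Suc k \<le> l")
    case False
    then have empty: "?P = {}" using length_le_of_mem_L_B by fastforce
    show ?thesis unfolding empty using False by simp
  qed (simp add: card_exact_length_partitions)
  ultimately show ?thesis by (simp add: card_Un_disjoint finite_desc_lists)
qed

text \<open>Iterating the split on the last entry sorts the lists by their number \<open>i\<close>
  of nonzero entries; removing one from each of these leaves a member of
  \<open>desc_lists (l - i) i\<close>. Values \<open>i > l\<close> are impossible, hence the
  minimum.\<close>

lemma card_desc_lists_rec:
  assumes "0 < l"
  shows "card (desc_lists l k) = (\<Sum>i = 1..min l k. card (desc_lists (l - i) i))"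
proof (induction k)
  case 0
  \<comment> \<open>The empty list does not have positive sum \<open>l\<close>, so both sides
    vanish.\<close>
  then show ?case using assms desc_lists_Suc_0[of "l - 1"] by simp
next
  case (Suc k)
  show ?case
  proof (cases "Suc k \<le> l")
    case True
    then have "min l (Suc k) = Suc k" "min l k = k" by auto
    then show ?thesis using Suc True card_desc_lists_Suc[of l k] by simp
  next
    case False
    then have "min l (Suc k) = l" "min l k = l" by auto
    then show ?thesis using Suc False card_desc_lists_Suc[of l k] by simp
  qed
qed

lemma card_desc_lists_1: "card (desc_lists l 1) = 1"
proof -
  have "desc_lists l 1 = {[l]}" by (auto simp: desc_lists_def length_Suc_conv)
  then show ?thesis by simp
qed

text \<open>Sorting the partitions by length, which runs from 1 to \<open>n\<close>, yields the
  right-hand side of the recurrence with \<open>k = n\<close>.\<close>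

lemma card_L_B:
  assumes "1 \<le> n"
  shows "card (L_B n) = card (desc_lists n n)"
proof -
  have fin: "finite {a \<in> L_B n. length a = k}" if "k \<le> n" for k
    unfolding exact_length_partitions_eq[OF that] by (simp add: finite_desc_lists)
  have "L_B n = (\<Union>k\<in>{1..n}. {a \<in> L_B n. length a = k})"
    using length_le_of_mem_L_B[of _ n] assms by (auto simp: L_B_def Suc_le_eq)
  then have "card (L_B n) = card (\<Union>k\<in>{1..n}. {a \<in> L_B n. length a = k})" by simp
  also have "\<dots> = (\<Sum>k = 1..n. card {a \<in> L_B n. length a = k})"
    by (rule card_UN_disjoint) (auto simp: fin)
  also have "\<dots> = (\<Sum>k = 1..n. card (desc_lists (n - k) k))"
    by (simp add: card_exact_length_partitions)
  also have "\<dots> = card (desc_lists n n)"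
    using card_desc_lists_rec[of n n] assms by simp
  finally show ?thesis .
qed

section \<open>Levels of the X subtree as decreasing lists\<close>

text \<open>All entries of \<open>drop k r\<close> are below \<open>part r 1\<close>, so any list
  raised by \<open>part r 1\<close> can stand in front of them. The first \<open>k\<close> parts of
  \<open>r\<close> sum to \<open>k * part r 1\<close>, which leaves a surplus of
  \<open>l\<close>.\<close>

lemma append_drop_in_X_nodes_level:
  assumes X: "X_root k r" and xs: "xs \<in> desc_lists l k"
  shows "map ((+) (part r 1)) xs @ drop k r \<in> {b \<in> X_nodes k r. sum_list b = sum_list r + l}"
proof -
  let ?m = "part r 1" and ?b = "map ((+) (part r 1)) xs @ drop k r"
  note r = X_rootD[OF X]
  have len: "length xs = k" using xs by (simp add: desc_lists_def)
  have drop: "0 < x \<and> x < ?m" if x: "x \<in> set (drop k r)" for x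
  proof -
    obtain j where "j < length r - k" and xj: "x = r ! (k + j)"
      using x by (auto simp: in_set_conv_nth)
    then have j: "k + j < length r" by simp
    then have "x = part r (Suc (k + j))" using xj by (simp add: part_def)
    then show ?thesis
      using j part_antimono[OF r(2), of "Suc k" "Suc (k + j)"] r(4) part_pos_iff[OF r(2), of "Suc (k + j)"] by simp
  qed
  have "sorted_wrt (\<ge>) (map ((+) ?m) xs)"
    using xs by (simp add: desc_lists_def sorted_wrt_map)
  moreover have "sorted_wrt (\<ge>) (drop k r)"
    using r(2) by (simp add: is_partition_def sorted_wrt_drop)
  moreover have "\<forall>x\<in>set (map ((+) ?m) xs). \<forall>y\<in>set (drop k r). y \<le> x"
    using drop by (auto intro: less_imp_le trans_less_add1)
  ultimately have "sorted_wrt (\<ge>) ?b" unfolding sorted_wrt_append by blast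
  moreover have "0 < ?m" using r(4) by simp
  then have "\<forall>x\<in>set ?b. 0 < x" using drop by auto
  ultimately have "is_partition ?b" by (simp add: is_partition_def)
  moreover have "part ?b j = part r j" if "k < j" for j
    using that len by (simp add: part_append part_drop)
  moreover have "?m \<le> part ?b k" using r(1) len by (simp add: part_def nth_append)
  moreover have k: "k \<le> length r"
    using part_pos_iff[OF r(2), of k] r(3)[of k] r(1,4) by simp
  have "take k r = replicate k ?m"
  proof (rule nth_equalityI)
    show "take k r ! j = replicate k ?m ! j" if "j < length (take k r)" for j
      using that k r(3)[of "Suc j"] part_def[of r "Suc j"] by simp
  qed (use k in simp)
  then have "sum_list r = k * ?m + sum_list (drop k r)"
    using arg_cong[OF append_take_drop_id[of k r], of sum_list] by (simp add: sum_list_replicate)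
  then have "sum_list ?b = sum_list r + l"
    using xs len sum_list_map_add[of ?m xs] by (simp add: desc_lists_def)
  ultimately show ?thesis by (simp add: X_nodes_def)
qed

lemma card_X_nodes_level:
  assumes X: "X_root k r"
  shows "card {b \<in> X_nodes k r. sum_list b = sum_list r + l} = card (desc_lists l k)"
proof -
  let ?m = "part r 1"
  let ?F = "\<lambda>xs. map ((+) ?m) xs @ drop k r"
  note r = X_rootD[OF X]
  have "bij_betw ?F (desc_lists l k) {b \<in> X_nodes k r. sum_list b = sum_list r + l}"
  proof (rule bij_betw_imageI)
    show "inj_on ?F (desc_lists l k)"
      by (rule inj_onI) (simp add: inj_map_eq_map)
    show "?F ` desc_lists l k = {b \<in> X_nodes k r. sum_list b = sum_list r + l}"
    proof (intro equalityI subsetI)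
      fix b assume "b \<in> {b \<in> X_nodes k r. sum_list b = sum_list r + l}"
      then have b: "b \<in> X_nodes k r" "sum_list b = sum_list r + l" by auto
      \<comment> \<open>The preimage is the excess of the first \<open>k\<close> parts over
        \<open>part r 1\<close>; the subtraction is not truncated, as these parts are at least
        \<open>part r 1\<close>.\<close>
      define xs where "xs = map (\<lambda>j. part b (Suc j) - ?m) [0..<k]"
      have sorted: "sorted_wrt (\<ge>) xs"
        using part_antimono[OF X_nodesD(1)[OF X b(1)]]
        by (auto simp: xs_def sorted_wrt_iff_nth_less intro!: diff_le_mono)
      \<comment> \<open>The level is left as \<open>sum_list xs\<close> and identified with
        \<open>l\<close> only once \<open>?F xs = b\<close> is known.\<close>
      then have xs: "xs \<in> desc_lists (sum_list xs) k" by (simp add: desc_lists_def xs_def)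
      note Fxs = append_drop_in_X_nodes_level[OF X xs]
      have "part (?F xs) j = part b j" for j
      proof (cases "1 \<le> j \<and> j \<le> k")
        case True
        then obtain i where i: "j = Suc i" "i < k" by (cases j) auto
        then have "length xs = k" "xs ! i = part b j - ?m" by (auto simp: xs_def)
        then have "part (?F xs) j = ?m + (part b j - ?m)"
          using i by (simp add: part_def[of "ys @ zs" for ys zs] nth_append)
        then show ?thesis using X_nodesD(3)[OF X b(1), of j] True by simp
      next
        case False
        then show ?thesis
          using X_nodesD(2)[OF X _ ] Fxs b(1) by (cases "j = 0") auto
      qed
      then have "?F xs = b"
        using part_inject X_nodesD(1)[OF X] Fxs b(1) by blast
      moreover from this have "sum_list xs = l" using Fxs b(2) by auto
      ultimately show "b \<in> ?F ` desc_lists l k" using xs by blast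
    qed (use append_drop_in_X_nodes_level[OF X] in blast)
  qed
  then show ?thesis using bij_betw_same_card by fastforce
qed

section \<open>Independence of the chosen subtree and conclusion\<close>

text \<open>The right-hand side does not mention \<open>r\<close> or \<open>S\<close>, so the choice
  of the subtree is immaterial.\<close>

lemma num_paths_X_subtree:
  assumes "X_subtree k r S"
  shows "num_paths S r l = card (desc_lists l k)"
proof -
  have X: "X_root k r" and S: "S = X_tree r" using assms by (auto simp: X_subtree_def)
  show ?thesis unfolding S num_paths_X_tree[OF X] by (rule card_X_nodes_level[OF X])
qed

text \<open>Guarantees that the \<open>SOME\<close> in the definition of \<open>c\<close> picks a
  genuine subtree; the root of \<open>k\<close> ones has common value 1 followed by 0.\<close>

lemma ex_X_subtree:
  assumes "1 \<le> k"
  shows "X_subtree k (replicate k 1) (X_tree (replicate k 1))"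
proof -
  have "is_partition (replicate k 1)"
    by (auto simp: is_partition_def sorted_wrt_iff_nth_less)
  moreover have "part (replicate k 1) j = 1" if "j \<in> {1..k}" for j
  proof -
    have "j - 1 < k" using that by auto
    then show ?thesis using that by (simp add: part_def)
  qed
  ultimately show ?thesis
    using assms by (auto simp: X_subtree_def X_root_def TB_simps part_beyond)
qed

lemma c_eq_card_desc_lists:
  assumes "1 \<le> k"
  shows "c l k = card (desc_lists l k)"
proof -
  obtain r S where rS: "(SOME (r, S). X_subtree k r S) = (r, S)" by (cases "SOME (r, S). X_subtree k r S")
  have "case (SOME (r, S). X_subtree k r S) of (r, S) \<Rightarrow> X_subtree k r S"
    by (rule someI[of _ "(replicate k 1, X_tree (replicate k 1))"]) (use ex_X_subtree[OF assms] in simp)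
  then have "X_subtree k r S" by (simp add: rS)
  then show ?thesis by (simp add: c_def rS num_paths_X_subtree)
qed

theorem corollary2:
  shows "(\<forall>l k r S. 1 \<le> k \<and> X_subtree k r S \<longrightarrow> num_paths S r l = c l k)
    \<and> (\<forall>l k. 1 \<le> k \<longrightarrow>
         c l k = (if l = 0 \<or> k = 1 then 1 else (\<Sum>i = 1..min l k. c (l - i) i)))
    \<and> (\<forall>n. 1 \<le> n \<longrightarrow> card (L_B n) = c n n)
    \<and> (\<forall>n k. 1 \<le> k \<and> k \<le> n \<longrightarrow> card {a \<in> L_B n. length a = k} = c (n - k) k)"
proof (intro conjI allI impI)
  fix l k :: nat assume k: "1 \<le> k"
  \<comment> \<open>The index \<open>i\<close> starts at 1, so \<open>c_eq_card_desc_lists\<close>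
    applies to every term.\<close>
  have "(\<Sum>i = 1..min l k. c (l - i) i) = (\<Sum>i = 1..min l k. card (desc_lists (l - i) i))"
    by (intro sum.cong) (auto simp: c_eq_card_desc_lists)
  then show "c l k = (if l = 0 \<or> k = 1 then 1 else (\<Sum>i = 1..min l k. c (l - i) i))"
    using card_desc_lists_0 card_desc_lists_1 card_desc_lists_rec[of l k]
    by (auto simp: c_eq_card_desc_lists[OF k])
qed (auto simp: c_eq_card_desc_lists num_paths_X_subtree card_L_B card_exact_length_partitions)

end
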